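(* Let $\Gamma$ be a Lie group acting smoothly, freely, and properly (on the left) on a smooth manifold $\tilde{X}$, let $X = \tilde{X}/\Gamma$ be the quotient manifold, and let $q : \tilde{X} \to X$ be the canonical quotient map. If $Y$ is a smooth manifold and $\tilde{s} : \tilde{X} \to Y$ is a smooth map that is constant along orbits, that is, if $$\tilde{s}(\tilde{x}) = \tilde{s}(\gamma \cdot \tilde{x}) \quad \text{for all } \tilde{x} \in \tilde{X} \text{ and } \gamma \in \Gamma,$$ then there exists a unique smooth map $s : X \to Y$ such that $\tilde{s} = s \circ q$.
   Context: For a left action $(\gamma,\tilde{x}) \mapsto \gamma\cdot\tilde{x}$ of $\Gamma$ on $\tilde{X}$, the orbit of $\tilde{x}$ is $\Gamma\cdot\tilde{x} = \{\gamma\cdot\tilde{x} \mid \gamma\in\Gamma\}$, the quotient $\tilde{X}/\Gamma$ is the set of orbits, and the canonical quotient map $q$ sends $\tilde{x}$ to its orbit. The action is free if $\gamma\cdot\tilde{x} = \tilde{x}$ for some $\tilde{x}\in\tilde{X}$ implies $\gamma = e$ (the identity of $\Gamma$). It is proper if the map $\Gamma\times\tilde{X}\to\tilde{X}\times\tilde{X}$, $(\gamma,\tilde{x})\mapsto(\gamma\cdot\tilde{x},\tilde{x})$, is a proper map (preimages of compact sets are compact). By the Quotient Manifold Theorem, for a smooth, free, and proper action of a Lie group, $X = \tilde{X}/\Gamma$ is a topological manifold of dimension $\dim\tilde{X}-\dim\Gamma$ with a unique smooth structure such that $q:\tilde{X}\to X$ is a smooth submersion; $X$ is equipped with this smooth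 structure. *)

theory Defs
  imports "HOL-Analysis.Analysis" "HOL-Algebra.Group_Action"
begin

section \<open>Model spaces\<close>

text \<open>
  Finite-dimensional real inner product spaces, i.e. up to isometry the spaces of column vectors of
  length $n \ge 0$. The library class \<^class>\<open>euclidean_space\<close> requires a nonempty basis and would
  thereby exclude dimension 0, in particular all discrete groups. The instance for \<^typ>\<open>unit\<close>
  below is the space of dimension 0.
\<close>

class finite_dim_inner = real_inner +
  assumes finite_spanning_sum: "\<exists>B. finite B \<and> (\<forall>x. \<exists>u. x = (\<Sum>b\<in>B. u b *\<^sub>R b))"

lemma finite_spanning: "\<exists>B::'a::finite_dim_inner set. finite B \<and> span B = UNIV"
proof -
  obtain B :: "'a set" where B: "finite B" "\<And>x. \<exists>u. x = (\<Sum>b\<in>B. u b *\<^sub>R b)"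
    using finite_spanning_sum by blast
  have "x \<in> span B" for x
  proof -
    obtain u where u: "x = (\<Sum>b\<in>B. u b *\<^sub>R b)"
      using B(2) by blast
    show ?thesis
      unfolding u by (intro span_sum span_scale span_base)
  qed
  then have "span B = UNIV" by (simp add: set_eq_iff)
  with B(1) show ?thesis by (intro exI conjI)
qed

lemma finite_spanning_sumI:
  fixes B :: "'a::real_vector set"
  assumes "finite B" "span B = UNIV"
  shows "\<exists>B::'a set. finite B \<and> (\<forall>x. \<exists>u. x = (\<Sum>b\<in>B. u b *\<^sub>R b))"
proof -
  have "\<exists>u. x = (\<Sum>b\<in>B. u b *\<^sub>R b)" for x
  proof -
    have "x \<in> range (\<lambda>u. \<Sum>b\<in>B. u b *\<^sub>R b)"
      unfolding span_finite[OF assms(1), symmetric] assms(2) by (rule UNIV_I)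
    then show ?thesis by (rule rangeE) (rule exI)
  qed
  with assms(1) show ?thesis by (intro exI[of _ B] conjI allI)
qed

instantiation unit :: real_inner
begin

definition zero_unit :: unit where "zero_unit = ()"
definition plus_unit :: "unit \<Rightarrow> unit \<Rightarrow> unit" where "plus_unit x y = ()"
definition scaleR_unit :: "real \<Rightarrow> unit \<Rightarrow> unit" where "scaleR_unit r x = ()"
definition sgn_unit :: "unit \<Rightarrow> unit" where "sgn_unit x = ()"
definition norm_unit :: "unit \<Rightarrow> real" where "norm_unit x = 0"
definition inner_unit :: "unit \<Rightarrow> unit \<Rightarrow> real" where "inner_unit x y = 0"
definition dist_unit :: "unit \<Rightarrow> unit \<Rightarrow> real" where "dist_unit x y = 0"
definition uniformity_unit :: "(unit \<times> unit) filter"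
  where "uniformity_unit = (INF e\<in>{0<..}. principal {(x, y). dist x y < e})"
definition open_unit :: "unit set \<Rightarrow> bool"
  where "open_unit U \<longleftrightarrow> (\<forall>x\<in>U. eventually (\<lambda>(x', y). x' = x \<longrightarrow> y \<in> U) uniformity)"

instance
  by standard
    (simp_all add: norm_unit_def inner_unit_def dist_unit_def uniformity_unit_def open_unit_def)

end

instance unit :: finite_dim_inner
  by standard (simp add: exI[of _ "{}"])

instance euclidean_space \<subseteq> finite_dim_inner
  by standard (rule finite_spanning_sumI[OF finite_Basis span_Basis])

instance prod :: (finite_dim_inner, finite_dim_inner) finite_dim_inner
proof
  obtain B :: "'a set" where B: "finite B" "span B = UNIV"
    using finite_spanning by blast
  obtain C :: "'b set" where C: "finite C" "span C = UNIV"
    using finite_spanning by blast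
  have "span (B \<times> {0} \<union> {0} \<times> C) = (UNIV :: ('a \<times> 'b) set)"
  proof -
    have "(x, y) \<in> span (B \<times> {0} \<union> {0} \<times> C)" for x :: 'a and y :: 'b
    proof -
      have "linear (\<lambda>x::'a. (x, 0::'b))" "linear (\<lambda>y::'b. (0::'a, y))"
        by (auto intro!: linearI)
      then have "(\<lambda>x::'a. (x, 0::'b)) ` UNIV = span ((\<lambda>x. (x, 0)) ` B)"
        and "(\<lambda>y::'b. (0::'a, y)) ` UNIV = span ((\<lambda>y. (0, y)) ` C)"
        using linear_span_image[of "\<lambda>x::'a. (x, 0::'b)" B]
          linear_span_image[of "\<lambda>y::'b. (0::'a, y)" C] B C by simp_all
      moreover have "(\<lambda>x::'a. (x, 0::'b)) ` B = B \<times> {0}" "(\<lambda>y::'b. (0::'a, y)) ` C = {0} \<times> C"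
        by auto
      ultimately have "(x, 0) \<in> span (B \<times> {0::'b})" "(0, y) \<in> span ({0::'a} \<times> C)"
        by (metis rangeI)+
      then have "(x, 0) + (0, y) \<in> span (B \<times> {0} \<union> {0} \<times> C)"
        by (meson span_add span_mono subsetD sup_ge1 sup_ge2)
      then show ?thesis by simp
    qed
    then show ?thesis by auto
  qed
  moreover have "finite (B \<times> {0::'b} \<union> {0::'a} \<times> C)"
    using B C by simp
  ultimately show "\<exists>B. finite B \<and> (\<forall>x :: 'a \<times> 'b. \<exists>u. x = (\<Sum>b\<in>B. u b *\<^sub>R b))"
    by (intro finite_spanning_sumI)
qed


section \<open>Smooth maps between open subsets of model spaces\<close>

text \<open>
  Existence and continuity of all iterated directional derivatives up to a given order. The set is
  meant to be open. The components of the total derivative of order \<open>n\<close> are the functions obtained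
  by differentiating \<open>n\<close> times along constant vectors, so for finite-dimensional domains this is
  membership in the usual class of \<open>n\<close> times continuously differentiable functions.
\<close>

primrec higher_differentiable_on ::
  "'a::real_normed_vector set \<Rightarrow> ('a \<Rightarrow> 'b::real_normed_vector) \<Rightarrow> nat \<Rightarrow> bool" where
  "higher_differentiable_on S f 0 \<longleftrightarrow> continuous_on S f"
| "higher_differentiable_on S f (Suc n) \<longleftrightarrow>
     (\<forall>x\<in>S. f differentiable (at x)) \<and>
     (\<forall>v. higher_differentiable_on S (\<lambda>x. frechet_derivative f (at x) v) n)"

definition smooth_on :: "'a::real_normed_vector set \<Rightarrow> ('a \<Rightarrow> 'b::real_normed_vector) \<Rightarrow> bool"
  where "smooth_on S f \<longleftrightarrow> (\<forall>n. higher_differentiable_on S f n)"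


section \<open>Smooth manifolds\<close>

text \<open>
  In a chart \<open>(U, f)\<close> only the values of \<open>f\<close> on \<open>U\<close> are relevant; its inverse is
  \<open>inv_into U f\<close>.
\<close>

type_synonym ('a, 'e) chart = "'a set \<times> ('a \<Rightarrow> 'e)"

definition is_chart :: "'a topology \<Rightarrow> ('a, 'e::real_normed_vector) chart \<Rightarrow> bool" where
  "is_chart T = (\<lambda>(U, f). openin T U \<and> open (f ` U) \<and>
     homeomorphic_map (subtopology T U) (top_of_set (f ` U)) f)"

definition smoothly_compatible ::
  "('a, 'e::real_normed_vector) chart \<Rightarrow> ('a, 'e) chart \<Rightarrow> bool" where
  "smoothly_compatible = (\<lambda>(U, f) (V, g).
     smooth_on (f ` (U \<inter> V)) (g \<circ> inv_into U f) \<and>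
     smooth_on (g ` (U \<inter> V)) (f \<circ> inv_into V g))"

definition smooth_atlas :: "'a topology \<Rightarrow> ('a, 'e::real_normed_vector) chart set \<Rightarrow> bool" where
  "smooth_atlas T A \<longleftrightarrow> (\<forall>c\<in>A. is_chart T c) \<and> \<Union> (fst ` A) = topspace T \<and>
     (\<forall>c\<in>A. \<forall>d\<in>A. smoothly_compatible c d)"

text \<open>For an atlas \<open>A\<close>, this is the unique maximal smooth atlas containing \<open>A\<close>.\<close>

definition maximal_atlas ::
  "'a topology \<Rightarrow> ('a, 'e::real_normed_vector) chart set \<Rightarrow> ('a, 'e) chart set" where
  "maximal_atlas T A = {c. is_chart T c \<and> (\<forall>d\<in>A. smoothly_compatible c d)}"

record ('a, 'e) manifold =
  mtop :: "'a topology"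
  charts :: "('a, 'e) chart set"

abbreviation points :: "('a, 'e) manifold \<Rightarrow> 'a set"
  where "points M \<equiv> topspace (mtop M)"

definition smooth_manifold :: "('a, 'e::finite_dim_inner) manifold \<Rightarrow> bool" where
  "smooth_manifold M \<longleftrightarrow>
     Hausdorff_space (mtop M) \<and> second_countable (mtop M) \<and>
     smooth_atlas (mtop M) (charts M) \<and> maximal_atlas (mtop M) (charts M) = charts M"

definition manifold_dim :: "('a, 'e::finite_dim_inner) manifold \<Rightarrow> nat"
  where "manifold_dim M = dim (UNIV :: 'e set)"

definition prod_manifold ::
  "('a, 'e::finite_dim_inner) manifold \<Rightarrow> ('b, 'f::finite_dim_inner) manifold \<Rightarrow>
    ('a \<times> 'b, 'e \<times> 'f) manifold" where
  "prod_manifold M N =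
     \<lparr>mtop = prod_topology (mtop M) (mtop N),
      charts = maximal_atlas (prod_topology (mtop M) (mtop N))
        {(U \<times> V, map_prod f g) | U f V g. (U, f) \<in> charts M \<and> (V, g) \<in> charts N}\<rparr>"

definition smooth_map ::
  "('a, 'e::finite_dim_inner) manifold \<Rightarrow> ('b, 'f::finite_dim_inner) manifold \<Rightarrow>
    ('a \<Rightarrow> 'b) \<Rightarrow> bool" where
  "smooth_map M N F \<longleftrightarrow> F \<in> points M \<rightarrow> points N \<and>
     (\<forall>p\<in>points M. \<exists>(U, f)\<in>charts M. \<exists>(V, g)\<in>charts N.
        p \<in> U \<and> F ` U \<subseteq> V \<and> smooth_on (f ` U) (g \<circ> F \<circ> inv_into U f))"

text \<open>
  The differential of \<open>F\<close> at \<open>p\<close> is expressed with respect to the coordinate bases of the tangent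
  spaces, as the derivative at \<open>f p\<close> of the coordinate representation of \<open>F\<close>.
\<close>

definition smooth_submersion ::
  "('a, 'e::finite_dim_inner) manifold \<Rightarrow> ('b, 'f::finite_dim_inner) manifold \<Rightarrow>
    ('a \<Rightarrow> 'b) \<Rightarrow> bool" where
  "smooth_submersion M N F \<longleftrightarrow> smooth_map M N F \<and>
     (\<forall>p\<in>points M. \<forall>(U, f)\<in>charts M. \<forall>(V, g)\<in>charts N. p \<in> U \<longrightarrow> F p \<in> V \<longrightarrow>
        surj (frechet_derivative (g \<circ> F \<circ> inv_into U f) (at (f p))))"


section \<open>Lie groups, actions and quotient manifolds\<close>

definition lie_group :: "('g, 'm) monoid_scheme \<Rightarrow> ('g, 'l::finite_dim_inner) manifold \<Rightarrow> bool"
  where "lie_group G L \<longleftrightarrow> group G \<and> smooth_manifold L \<and> points L = carrier G \<and>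
     smooth_map (prod_manifold L L) L (\<lambda>(x, y). x \<otimes>\<^bsub>G\<^esub> y) \<and>
     smooth_map L L (\<lambda>x. inv\<^bsub>G\<^esub> x)"

definition smooth_action ::
  "('g, 'm) monoid_scheme \<Rightarrow> ('g, 'l::finite_dim_inner) manifold \<Rightarrow>
    ('a, 'e::finite_dim_inner) manifold \<Rightarrow> ('g \<Rightarrow> 'a \<Rightarrow> 'a) \<Rightarrow> bool" where
  "smooth_action G L M \<phi> \<longleftrightarrow> group_action G (points M) \<phi> \<and>
     smooth_map (prod_manifold L M) M (\<lambda>(\<gamma>, x). \<phi> \<gamma> x)"

definition free_action ::
  "('g, 'm) monoid_scheme \<Rightarrow> 'a set \<Rightarrow> ('g \<Rightarrow> 'a \<Rightarrow> 'a) \<Rightarrow> bool" where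
  "free_action G E \<phi> \<longleftrightarrow> (\<forall>\<gamma>\<in>carrier G. (\<exists>x\<in>E. \<phi> \<gamma> x = x) \<longrightarrow> \<gamma> = \<one>\<^bsub>G\<^esub>)"

text \<open>
  Properness is defined through preimages of compact sets, whereas \<^const>\<open>proper_map\<close> asks for
  closed maps with compact fibres.
\<close>

definition proper_action :: "'g topology \<Rightarrow> 'a topology \<Rightarrow> ('g \<Rightarrow> 'a \<Rightarrow> 'a) \<Rightarrow> bool" where
  "proper_action S T \<phi> \<longleftrightarrow>
     (\<forall>K. compactin (prod_topology T T) K \<longrightarrow>
        compactin (prod_topology S T)
          {(\<gamma>, x). \<gamma> \<in> topspace S \<and> x \<in> topspace T \<and> (\<phi> \<gamma> x, x) \<in> K})"

text \<open>
  \<open>X\<close> is the orbit space of the action with the structure provided by the quotient manifold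
  theorem. The points of \<open>X\<close> are the orbits and \<open>orbit G \<phi>\<close> is the canonical quotient map.
\<close>

definition quotient_manifold ::
  "('g, 'm) monoid_scheme \<Rightarrow> ('g, 'l::finite_dim_inner) manifold \<Rightarrow>
    ('a, 'e::finite_dim_inner) manifold \<Rightarrow> ('g \<Rightarrow> 'a \<Rightarrow> 'a) \<Rightarrow>
    ('a set, 'f::finite_dim_inner) manifold \<Rightarrow> bool" where
  "quotient_manifold G L M \<phi> X \<longleftrightarrow>
     smooth_manifold X \<and>
     points X = orbits G (points M) \<phi> \<and>
     quotient_map (mtop M) (mtop X) (orbit G \<phi>) \<and>
     manifold_dim X + manifold_dim L = manifold_dim M \<and>
     smooth_submersion M X (orbit G \<phi>)"

end

theory Submission
  imports Defs
begin

text \<open>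
  Write \<open>q\<close> for the quotient map. The map \<open>st\<close> is constant on the fibres of \<open>q\<close>, because these are the
  orbits, and \<open>q\<close> is onto; so there is exactly one map \<open>s\<close> on the orbit space with \<open>st = s \<circ> q\<close>. What
  has to be shown is that \<open>s\<close> is smooth. Since \<open>q\<close> is a submersion, every point of the orbit space has
  a neighbourhood on which \<open>q\<close> has a smooth section \<open>\<sigma>\<close>, and there \<open>s = s \<circ> q \<circ> \<sigma> = st \<circ> \<sigma>\<close> is a
  composition of smooth maps. This is \<open>smooth_map_descends_along_submersion\<close>, which is stated for an
  arbitrary surjective submersion \<open>q\<close>.

  The local section is constructed in coordinates (\<open>submersion_smooth_local_section\<close>). If the
  derivative of \<open>F\<close> at \<open>p\<close> is onto, it has a linear right inverse \<open>R\<close>, and \<open>H x = F (p + R x)\<close> maps a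
  neighbourhood of 0 to the target space, with the identity as derivative at 0. A local inverse \<open>g\<close> of
  \<open>H\<close> gives the section \<open>y \<mapsto> p + R (g y)\<close>. That \<open>g\<close> exists and is smooth is an inverse function theorem
  for maps close to the identity (\<open>smooth_inverse_near_identity\<close>): solutions of \<open>H x = y\<close> are fixed
  points of a contraction, the derivative of \<open>g\<close> at \<open>y\<close> is the inverse of the derivative of \<open>H\<close> at
  \<open>g y\<close>, and smoothness follows by induction on the order, because inversion of a smooth family of
  linear operators is smooth (\<open>inverse_family.inverse_higher_differentiable_on\<close>).
\<close>

section \<open>Orthonormal frames of model spaces\<close>

text \<open>
  Gram--Schmidt orthogonalization of a finite spanning set, after which zero vectors are dropped
  and the others normalized. The difference between \<open>x\<close> and its expansion is orthogonal to the
  frame, hence to everything. In dimension 0 the frame is empty.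
\<close>

lemma ex_orthonormal_frame:
  "\<exists>B::'a::finite_dim_inner set. finite B \<and> (\<forall>b\<in>B. norm b = 1) \<and>
     (\<forall>x. (\<Sum>b\<in>B. (x \<bullet> b) *\<^sub>R b) = x)"
proof -
  obtain B0 :: "'a set" where "finite B0" "span B0 = UNIV"
    using finite_spanning by blast
  then obtain C :: "'a set" where C: "finite C" "span C = UNIV" "pairwise orthogonal C"
    using basis_orthogonal by metis
  define B where "B = sgn ` (C - {0})"
  have fin: "finite B" and unit: "\<forall>b\<in>B. norm b = 1"
    using C(1) by (auto simp: B_def norm_sgn)
  have "span B = span (C - {0})"
    using span_image_scale[of "C - {0}" "\<lambda>x. inverse (norm x)"] C(1)
    by (simp add: B_def sgn_div_norm[abs_def])
  then have span: "span B = UNIV"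
    using C(2) by (simp add: span_delete_0)
  have orth: "b \<bullet> c = 0" if "b \<in> B" "c \<in> B" "b \<noteq> c" for b c
  proof -
    obtain b' c' where "b' \<in> C" "c' \<in> C" "b = sgn b'" "c = sgn c'" "b' \<noteq> c'"
      using \<open>b \<in> B\<close> \<open>c \<in> B\<close> \<open>b \<noteq> c\<close> unfolding B_def by blast
    then show ?thesis
      using C(3) by (simp add: pairwise_def orthogonal_def sgn_div_norm)
  qed
  have "(\<Sum>b\<in>B. (x \<bullet> b) *\<^sub>R b) = x" for x
  proof -
    define r where "r = x - (\<Sum>b\<in>B. (x \<bullet> b) *\<^sub>R b)"
    have B: "r \<bullet> c = 0" if "c \<in> B" for c
    proof -
      have "(\<Sum>b\<in>B. (x \<bullet> b) * (b \<bullet> c)) = (\<Sum>b\<in>B. if b = c then x \<bullet> c else 0)"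
        using unit orth that by (intro sum.cong) (auto simp: dot_square_norm)
      then show ?thesis
        using that fin by (simp add: r_def inner_diff_left inner_sum_left)
    qed
    have "r \<bullet> y = 0" if "y \<in> span B" for y
      using that by (induction y rule: span_induct_alt) (simp_all add: inner_add_right B)
    then have "r \<bullet> r = 0" by (simp add: span)
    then show ?thesis by (simp add: r_def)
  qed
  with fin unit show ?thesis by blast
qed

definition frame :: "'a::finite_dim_inner set" where
  "frame = (SOME B. finite B \<and> (\<forall>b\<in>B. norm b = 1) \<and> (\<forall>x. (\<Sum>b\<in>B. (x \<bullet> b) *\<^sub>R b) = x))"

lemma finite_frame [simp]: "finite frame"
  and norm_frame [simp]: "b \<in> frame \<Longrightarrow> norm b = 1"
  and frame_expansion: "(\<Sum>b\<in>frame. (x \<bullet> b) *\<^sub>R b) = x"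
  using someI_ex[OF ex_orthonormal_frame] unfolding frame_def by blast+

lemma linear_frame_expansion:
  fixes f :: "'a::finite_dim_inner \<Rightarrow> 'b::real_vector"
  assumes "linear f"
  shows "f x = (\<Sum>b\<in>frame. (x \<bullet> b) *\<^sub>R f b)"
proof -
  have "f (\<Sum>b\<in>frame. (x \<bullet> b) *\<^sub>R b) = (\<Sum>b\<in>frame. (x \<bullet> b) *\<^sub>R f b)"
    by (simp add: linear_sum[OF assms] linear_scale[OF assms])
  then show ?thesis by (simp add: frame_expansion)
qed

text \<open>
  Continuity of derivatives is only given one direction at a time. This estimate turns finitely many
  directional bounds into a bound that is uniform in the direction.
\<close>

lemma linear_norm_le_frame:
  fixes f :: "'a::finite_dim_inner \<Rightarrow> 'b::real_normed_vector"
  assumes "linear f" and "\<And>b. b \<in> frame \<Longrightarrow> norm (f b) \<le> e"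
  shows "norm (f x) \<le> (e * real (card (frame :: 'a set))) * norm x"
proof -
  have "norm (f x) \<le> (\<Sum>b\<in>(frame :: 'a set). norm x * e)"
    unfolding linear_frame_expansion[OF assms(1), of x]
  proof (rule sum_norm_le)
    fix b :: 'a assume b: "b \<in> frame"
    have "\<bar>x \<bullet> b\<bar> \<le> norm x"
      using Cauchy_Schwarz_ineq2[of x b] b by simp
    then show "norm ((x \<bullet> b) *\<^sub>R f b) \<le> norm x * e"
      using assms(2)[OF b] by (simp add: mult_mono')
  qed
  then show ?thesis by (simp add: algebra_simps)
qed

lemma finite_dim_linear_imp_bounded_linear:
  fixes f :: "'a::finite_dim_inner \<Rightarrow> 'b::real_normed_vector"
  assumes "linear f"
  shows "bounded_linear f"
proof (rule bounded_linear_intro[where K = "(\<Sum>b\<in>frame. norm (f b)) * real (card (frame::'a set))"])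
  fix x show "norm (f x) \<le> norm x * ((\<Sum>b\<in>frame. norm (f b)) * real (card (frame::'a set)))"
    using linear_norm_le_frame[OF assms, of "\<Sum>b\<in>frame. norm (f b)" x]
      member_le_sum[of _ frame "\<lambda>b. norm (f b)"]
    by (simp add: mult.commute)
qed (simp_all add: linear_add[OF assms] linear_scale[OF assms])

text \<open>
  Completeness is what makes the contraction principle applicable below; it is inherited from
  the reals coordinate by coordinate.
\<close>

lemma complete_UNIV_finite_dim: "complete (UNIV :: 'a::finite_dim_inner set)"
proof (rule completeI)
  fix X :: "nat \<Rightarrow> 'a" assume X: "Cauchy X"
  have "convergent (\<lambda>n. X n \<bullet> b)" for b
    using bounded_linear.Cauchy[OF bounded_linear_inner_left X] by (simp add: Cauchy_convergent)
  then have "(\<lambda>n. X n \<bullet> b) \<longlonglongrightarrow> lim (\<lambda>n. X n \<bullet> b)" for b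
    by (simp add: convergent_LIMSEQ_iff)
  then have "(\<lambda>n. \<Sum>b\<in>frame. (X n \<bullet> b) *\<^sub>R b) \<longlonglongrightarrow> (\<Sum>b\<in>frame. lim (\<lambda>n. X n \<bullet> b) *\<^sub>R b)"
    by (intro tendsto_intros)
  then show "\<exists>l\<in>UNIV. X \<longlonglongrightarrow> l" by (auto simp: frame_expansion)
qed


section \<open>Closure properties of higher differentiability\<close>

lemma higher_differentiable_on_subset:
  "higher_differentiable_on S f n \<Longrightarrow> T \<subseteq> S \<Longrightarrow> higher_differentiable_on T f n"
  by (induction n arbitrary: f) (auto intro: continuous_on_subset)

lemma higher_differentiable_on_SucD:
  assumes "higher_differentiable_on S f (Suc n)"
  shows "x \<in> S \<Longrightarrow> (f has_derivative frechet_derivative f (at x)) (at x)"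
    and "higher_differentiable_on S (\<lambda>x. frechet_derivative f (at x) v) n"
  using assms frechet_derivative_works by auto

text \<open>
  Openness is essential here: the derivatives are taken in the whole space, so the maps have to
  agree near each point of the set.
\<close>

lemma higher_differentiable_on_cong:
  assumes "open S" and "\<And>x. x \<in> S \<Longrightarrow> f x = g x" and "higher_differentiable_on S f n"
  shows "higher_differentiable_on S g n"
  using assms(2,3)
proof (induction n arbitrary: f g)
  case 0
  then show ?case by (auto cong: continuous_on_cong)
next
  case (Suc n)
  note D = higher_differentiable_on_SucD[OF Suc.prems(2)]
  have Dg: "(g has_derivative frechet_derivative f (at x)) (at x)" if "x \<in> S" for x
    using has_derivative_transform_within_open[OF D(1)[OF that] assms(1) that Suc.prems(1)] .
  have "higher_differentiable_on S (\<lambda>x. frechet_derivative g (at x) v) n" for v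
    using frechet_derivative_at[OF Dg] by (intro Suc.IH[OF _ D(2)]) simp
  then show ?case
    using Dg by (auto simp: differentiable_def)
qed

text \<open>
  This rule allows the closure properties to be proved by induction on the order, with the
  derivative given by a formula and not as a \<open>frechet_derivative\<close>.
\<close>

lemma higher_differentiable_on_SucI:
  assumes "open S" and "\<And>x. x \<in> S \<Longrightarrow> (f has_derivative D x) (at x)"
    and "\<And>v. higher_differentiable_on S (\<lambda>x. D x v) n"
  shows "higher_differentiable_on S f (Suc n)"
proof -
  have "frechet_derivative f (at x) = D x" if "x \<in> S" for x
    using assms(2)[OF that] by (rule frechet_derivative_at[symmetric])
  then have "higher_differentiable_on S (\<lambda>x. frechet_derivative f (at x) v) n" for v
    by (intro higher_differentiable_on_cong[OF assms(1) _ assms(3)[of v]]) simp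
  then show ?thesis
    using assms(2) by (auto simp: differentiable_def)
qed

lemma higher_differentiable_on_Suc_lower:
  "higher_differentiable_on S f (Suc n) \<Longrightarrow> higher_differentiable_on S f n"
proof (induction n arbitrary: f)
  case 0
  then show ?case
    by (auto intro!: continuous_at_imp_continuous_on differentiable_imp_continuous_within)
next
  case (Suc n)
  then show ?case by (metis higher_differentiable_on.simps(2))
qed

lemma higher_differentiable_on_const: "higher_differentiable_on S (\<lambda>x. c) n"
proof (induction n arbitrary: c)
  case (Suc n)
  then show ?case by (simp add: frechet_derivative_const)
qed simp

lemma higher_differentiable_on_affine:
  assumes "open S" "bounded_linear f"
  shows "higher_differentiable_on S (\<lambda>x. c + f x) n"
proof (cases n)
  case 0
  then show ?thesis
    using linear_continuous_on[OF assms(2)] by (simp add: continuous_on_add)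
next
  case (Suc m)
  have "((\<lambda>x. c + f x) has_derivative f) (at x)" for x
    using bounded_linear.has_derivative[OF assms(2) has_derivative_ident]
    by (auto intro!: derivative_eq_intros)
  then show ?thesis
    unfolding Suc
    by (rule higher_differentiable_on_SucI[OF assms(1) _ higher_differentiable_on_const])
qed

lemma higher_differentiable_on_add:
  assumes "open S" "higher_differentiable_on S f n" "higher_differentiable_on S g n"
  shows "higher_differentiable_on S (\<lambda>x. f x + g x) n"
  using assms(2,3)
proof (induction n arbitrary: f g)
  case 0
  then show ?case by (simp add: continuous_on_add)
next
  case (Suc n)
  note D = higher_differentiable_on_SucD[OF Suc.prems(1)] higher_differentiable_on_SucD[OF Suc.prems(2)]
  show ?case
  proof (rule higher_differentiable_on_SucI[OF assms(1)])
    show "((\<lambda>x. f x + g x) has_derivative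
        (\<lambda>v. frechet_derivative f (at x) v + frechet_derivative g (at x) v)) (at x)" if "x \<in> S" for x
      using has_derivative_add[OF D(1,3)[OF that]] .
    show "higher_differentiable_on S
        (\<lambda>x. frechet_derivative f (at x) v + frechet_derivative g (at x) v) n" for v
      using Suc.IH[OF D(2,4)] .
  qed
qed

lemma higher_differentiable_on_sum:
  assumes "open S" "\<And>i. i \<in> I \<Longrightarrow> higher_differentiable_on S (f i) n"
  shows "higher_differentiable_on S (\<lambda>x. \<Sum>i\<in>I. f i x) n"
  using assms(2)
  by (induction I rule: infinite_finite_induct)
    (auto intro!: higher_differentiable_on_const higher_differentiable_on_add[OF assms(1)])

lemma higher_differentiable_on_bounded_linear:
  assumes "open S" "bounded_linear L" "higher_differentiable_on S f n"
  shows "higher_differentiable_on S (\<lambda>x. L (f x)) n"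
  using assms(3)
proof (induction n arbitrary: f)
  case 0
  then show ?case by (simp add: bounded_linear.continuous_on[OF assms(2)])
next
  case (Suc n)
  note D = higher_differentiable_on_SucD[OF Suc.prems(1)]
  show ?case
  proof (rule higher_differentiable_on_SucI[OF assms(1)])
    show "((\<lambda>x. L (f x)) has_derivative (\<lambda>v. L (frechet_derivative f (at x) v))) (at x)"
      if "x \<in> S" for x
      using bounded_linear.has_derivative[OF assms(2) D(1)[OF that]] .
    show "higher_differentiable_on S (\<lambda>x. L (frechet_derivative f (at x) v)) n" for v
      using Suc.IH[OF D(2)] .
  qed
qed

lemma higher_differentiable_on_scaleR:
  assumes "open S" "higher_differentiable_on S f n" "higher_differentiable_on S g n"
  shows "higher_differentiable_on S (\<lambda>x. f x *\<^sub>R g x) n"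
  using assms(2,3)
proof (induction n arbitrary: f g)
  case 0
  then show ?case by (simp add: continuous_on_scaleR)
next
  case (Suc n)
  note D = higher_differentiable_on_SucD[OF Suc.prems(1)] higher_differentiable_on_SucD[OF Suc.prems(2)]
  show ?case
  proof (rule higher_differentiable_on_SucI[OF assms(1)])
    show "((\<lambda>x. f x *\<^sub>R g x) has_derivative (\<lambda>v. f x *\<^sub>R frechet_derivative g (at x) v
        + frechet_derivative f (at x) v *\<^sub>R g x)) (at x)" if "x \<in> S" for x
      using has_derivative_scaleR[OF D(1,3)[OF that]] .
    show "higher_differentiable_on S (\<lambda>x. f x *\<^sub>R frechet_derivative g (at x) v
        + frechet_derivative f (at x) v *\<^sub>R g x) n" for v
      using higher_differentiable_on_add[OF assms(1)
          Suc.IH[OF higher_differentiable_on_Suc_lower[OF Suc.prems(1)] D(4)]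
          Suc.IH[OF D(2) higher_differentiable_on_Suc_lower[OF Suc.prems(2)]]] .
  qed
qed

text \<open>
  A linear operator applied to a vector is the sum of its values on a frame, weighted by the
  coordinates of the vector. Hence pointwise differentiability of an operator family suffices to
  apply it to a variable argument. The chain rule and the inversion of operators are both
  reduced to this product rule.
\<close>

lemma higher_differentiable_on_apply:
  fixes z :: "'a::real_normed_vector \<Rightarrow> 'b::finite_dim_inner"
  assumes "open S" "\<And>x. x \<in> S \<Longrightarrow> linear (A x)"
    and "\<And>b. higher_differentiable_on S (\<lambda>x. A x b) n" "higher_differentiable_on S z n"
  shows "higher_differentiable_on S (\<lambda>x. A x (z x)) n"
proof (rule higher_differentiable_on_cong[OF assms(1)])
  show "higher_differentiable_on S (\<lambda>x. \<Sum>b\<in>frame. (z x \<bullet> b) *\<^sub>R A x b) n"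
    using assms
    by (intro higher_differentiable_on_sum higher_differentiable_on_scaleR
        higher_differentiable_on_bounded_linear[OF _ bounded_linear_inner_left])
  show "(\<Sum>b\<in>frame. (z x \<bullet> b) *\<^sub>R A x b) = A x (z x)" if "x \<in> S" for x
    using linear_frame_expansion[OF assms(2)[OF that]] by metis
qed

text \<open>
  The derivative of \<open>g \<circ> f\<close> in direction \<open>v\<close> is the operator \<open>Dg (f x)\<close> applied to \<open>Df x v\<close>. The
  entries of the former are compositions with \<open>f\<close> of maps that are differentiable to one
  order less than \<open>g\<close>, so the induction needs \<open>g\<close> to be arbitrary while \<open>f\<close> stays fixed.
\<close>

lemma higher_differentiable_on_compose:
  fixes f :: "'a::real_normed_vector \<Rightarrow> 'b::finite_dim_inner"
  assumes "open S" "open T" "f ` S \<subseteq> T"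
    and "higher_differentiable_on S f n" "higher_differentiable_on T g n"
  shows "higher_differentiable_on S (\<lambda>x. g (f x)) n"
  using assms(4,5)
proof (induction n arbitrary: g)
  case 0
  then show ?case
    using continuous_on_compose2[OF _ _ assms(3)] by auto
next
  case (Suc n)
  note Df = higher_differentiable_on_SucD[OF Suc.prems(1)]
  note Dg = higher_differentiable_on_SucD[OF Suc.prems(2)]
  show ?case
  proof (rule higher_differentiable_on_SucI[OF assms(1)])
    fix x assume x: "x \<in> S"
    show "((\<lambda>x. g (f x)) has_derivative
        (\<lambda>v. frechet_derivative g (at (f x)) (frechet_derivative f (at x) v))) (at x)"
      using x assms(3) by (intro has_derivative_compose[OF Df(1)] Dg(1)) auto
  next
    fix v
    show "higher_differentiable_on S
        (\<lambda>x. frechet_derivative g (at (f x)) (frechet_derivative f (at x) v)) n"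
    proof (rule higher_differentiable_on_apply[OF assms(1) _ _ Df(2)])
      show "linear (frechet_derivative g (at (f x)))" if "x \<in> S" for x
        using that assms(3) has_derivative_linear[OF Dg(1)] by blast
      show "higher_differentiable_on S (\<lambda>x. frechet_derivative g (at (f x)) b) n" for b
        using Suc.IH[OF higher_differentiable_on_Suc_lower[OF Suc.prems(1)] Dg(2)] .
    qed
  qed
qed

lemma smooth_on_subset: "smooth_on S f \<Longrightarrow> T \<subseteq> S \<Longrightarrow> smooth_on T f"
  using higher_differentiable_on_subset unfolding smooth_on_def by blast

lemma smooth_on_cong:
  "open S \<Longrightarrow> (\<And>x. x \<in> S \<Longrightarrow> f x = g x) \<Longrightarrow> smooth_on S f \<Longrightarrow> smooth_on S g"
  using higher_differentiable_on_cong unfolding smooth_on_def by blast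

lemma smooth_on_compose:
  fixes f :: "'a::real_normed_vector \<Rightarrow> 'b::finite_dim_inner"
  assumes "open S" "open T" "f ` S \<subseteq> T" "smooth_on S f" "smooth_on T g"
  shows "smooth_on S (\<lambda>x. g (f x))"
  using assms higher_differentiable_on_compose unfolding smooth_on_def by blast

section \<open>Inverse functions near the identity\<close>

text \<open>
  Newton iteration with the identity as approximate derivative: a solution of \<open>H x = z\<close> is a
  fixed point of \<open>x \<mapsto> x + (z - H x)\<close>, which has Lipschitz constant 1/2 on the ball.
\<close>

lemma near_identity_covers:
  fixes H :: "'a::finite_dim_inner \<Rightarrow> 'a"
  assumes "\<And>x y. x \<in> cball a r \<Longrightarrow> y \<in> cball a r \<Longrightarrow>
      norm ((H x - x) - (H y - y)) \<le> norm (x - y) / 2"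
    and "norm (z - H a) \<le> r / 2"
  shows "\<exists>x\<in>cball a r. H x = z"
proof -
  have r: "0 \<le> r" using assms(2) norm_ge_zero[of "z - H a"] by linarith
  have "\<exists>!x\<in>cball a r. x + (z - H x) = x"
  proof (rule Banach_fix[where c = "1/2"])
    show "complete (cball a r)"
      by (rule complete_closed_subset[OF closed_cball subset_UNIV complete_UNIV_finite_dim])
    show "cball a r \<noteq> {}" using r by simp
    show "dist (x + (z - H x)) (y + (z - H y)) \<le> 1/2 * dist x y"
      if "x \<in> cball a r" "y \<in> cball a r" for x y
    proof -
      have "(x + (z - H x)) - (y + (z - H y)) = - ((H x - x) - (H y - y))"
        by simp
      then have "dist (x + (z - H x)) (y + (z - H y)) = norm ((H x - x) - (H y - y))"
        by (simp only: dist_norm norm_minus_cancel)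
      then show ?thesis
        using assms(1)[OF that] by (simp add: dist_norm)
    qed
    show "(\<lambda>x. x + (z - H x)) ` cball a r \<subseteq> cball a r"
    proof clarify
      fix x assume x: "x \<in> cball a r"
      have "x + (z - H x) - a = (z - H a) - ((H x - x) - (H a - a))"
        by simp
      then have "norm (x + (z - H x) - a) \<le> norm (z - H a) + norm ((H x - x) - (H a - a))"
        using norm_triangle_ineq4 by metis
      also have "\<dots> \<le> r / 2 + norm (x - a) / 2"
        using assms(1)[OF x] assms(2) r by (intro add_mono) auto
      also have "\<dots> \<le> r"
        using x by (simp add: dist_norm norm_minus_commute)
      finally show "x + (z - H x) \<in> cball a r"
        by (simp add: dist_norm norm_minus_commute)
    qed
  qed auto
  then obtain x where "x \<in> cball a r" "x + (z - H x) = x" by blast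
  then show ?thesis by (intro bexI[of _ x]) simp_all
qed

text \<open>
  The assumption bounds \<open>norm v\<close> by \<open>2 * norm (A v)\<close>, which gives injectivity and the bound for the
  inverse. Surjectivity is the preceding lemma on a ball around 0 large enough for the given
  target.
\<close>

lemma near_identity_linear_inverse:
  fixes A :: "'a::finite_dim_inner \<Rightarrow> 'a"
  assumes "linear A" and near: "\<And>v. norm (A v - v) \<le> norm v / 2"
  shows "linear (inv_into UNIV A)"
    and "A (inv_into UNIV A v) = v"
    and "inv_into UNIV A (A v) = v"
    and "norm (inv_into UNIV A v) \<le> 2 * norm v"
proof -
  have lower: "norm v \<le> 2 * norm (A v)" for v
    using near[of v] norm_triangle_ineq3[of "A v" v] by linarith
  have "inj A"
  proof (rule injI)
    fix x y assume "A x = A y"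
    then show "x = y"
      using lower[of "x - y"] by (simp add: linear_diff[OF assms(1)])
  qed
  have "\<exists>x\<in>cball 0 (2 * norm w). A x = w" for w
  proof (rule near_identity_covers)
    show "norm ((A x - x) - (A y - y)) \<le> norm (x - y) / 2" for x y
      using near[of "x - y"] by (simp add: linear_diff[OF assms(1)] algebra_simps)
    show "norm (w - A 0) \<le> 2 * norm w / 2"
      by (simp add: linear_0[OF assms(1)])
  qed
  then have "surj A" unfolding surj_def by metis
  show AB: "A (inv_into UNIV A v) = v" for v
    using \<open>surj A\<close> by (rule surj_f_inv_f)
  show BA: "inv_into UNIV A (A v) = v" for v
    using \<open>inj A\<close> by (rule inv_f_f)
  show "linear (inv_into UNIV A)"
  proof (rule linearI)
    fix x y :: 'a and r :: real
    have "A (inv_into UNIV A x + inv_into UNIV A y) = x + y"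
      by (simp add: linear_add[OF assms(1)] AB)
    then show "inv_into UNIV A (x + y) = inv_into UNIV A x + inv_into UNIV A y"
      using BA by metis
    have "A (r *\<^sub>R inv_into UNIV A x) = r *\<^sub>R x"
      by (simp add: linear_scale[OF assms(1)] AB)
    then show "inv_into UNIV A (r *\<^sub>R x) = r *\<^sub>R inv_into UNIV A x"
      using BA by metis
  qed
  show "norm (inv_into UNIV A v) \<le> 2 * norm v"
    using lower[of "inv_into UNIV A v"] by (simp add: AB)
qed

text \<open>
  The operators \<open>B x\<close> are the inverses of the operators \<open>A x\<close>, and the uniform bound \<open>K\<close> makes
  inversion continuous. The family is treated through its values \<open>A x b\<close> on fixed vectors, which is the
  form in which derivatives of smooth maps provide such families.
\<close>

locale inverse_family =
  fixes S :: "'a::finite_dim_inner set" and A B :: "'a \<Rightarrow> 'b::finite_dim_inner \<Rightarrow> 'b" and K :: real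
  assumes open_S: "open S"
    and linear_A: "x \<in> S \<Longrightarrow> linear (A x)"
    and linear_B: "x \<in> S \<Longrightarrow> linear (B x)"
    and A_B: "x \<in> S \<Longrightarrow> A x (B x v) = v"
    and B_A: "x \<in> S \<Longrightarrow> B x (A x v) = v"
    and B_bound: "x \<in> S \<Longrightarrow> norm (B x v) \<le> K * norm v"
begin

text \<open>
  The resolvent identity \<open>B\<^sub>y - B\<^sub>x = - B\<^sub>y (A\<^sub>y - A\<^sub>x) B\<^sub>x\<close>, from which continuity and
  differentiability of the inverses are derived.
\<close>

lemma inverse_difference:
  assumes "x \<in> S" "y \<in> S"
  shows "B y v - B x v = - B y (A y (B x v) - A x (B x v))"
  using assms by (simp add: A_B B_A linear_diff[OF linear_B])

lemma eventually_in_S: "x \<in> S \<Longrightarrow> eventually (\<lambda>y. y \<in> S) (at x)"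
  using open_S by (auto simp: eventually_at_topological)

lemma inverse_isCont:
  assumes "x \<in> S" and "\<And>b. isCont (\<lambda>y. A y b) x"
  shows "isCont (\<lambda>y. B y v) x"
  unfolding isCont_def
proof (rule LIM_zero_cancel, rule Lim_null_comparison)
  show "\<forall>\<^sub>F y in at x. norm (B y v - B x v) \<le> K * norm (A y (B x v) - A x (B x v))"
    using eventually_in_S[OF assms(1)]
    by eventually_elim (simp only: inverse_difference[OF assms(1)] norm_minus_cancel B_bound)
  show "(\<lambda>y. K * norm (A y (B x v) - A x (B x v))) \<midarrow>x\<rightarrow> 0"
    using assms(2)[of "B x v"] unfolding isCont_def
    by (intro tendsto_mult_right_zero tendsto_norm_zero LIM_zero)
qed

text \<open>
  With \<open>w = B x v\<close>, the resolvent identity reads \<open>B y v - B x v = - B y (A y w - A x w)\<close>. Replacing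
  \<open>A y w - A x w\<close> by its linear part costs an error of lower order, because \<open>B y\<close> is bounded
  by \<open>K\<close>. Replacing \<open>B y\<close> by \<open>B x\<close> afterwards costs at most \<open>e y * norm (y - x)\<close> up to a constant,
  where \<open>e y\<close> tends to 0 by continuity of the inverses.
\<close>

lemma inverse_has_derivative:
  assumes x: "x \<in> S" and deriv: "\<And>b. ((\<lambda>y. A y b) has_derivative (\<lambda>u. A' u b)) (at x)"
  shows "((\<lambda>y. B y v) has_derivative (\<lambda>u. - B x (A' u (B x v)))) (at x)"
proof -
  define w where "w = B x v"
  have cont: "isCont (\<lambda>y. B y z) x" for z
    using inverse_isCont[OF x has_derivative_continuous[OF deriv]] .
  have lin: "linear (\<lambda>u. A' u w)"
    using deriv has_derivative_linear by blast
  define e where "e y = (\<Sum>b\<in>frame. norm (B y (A' b w) - B x (A' b w)))" for y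
  let ?q = "\<lambda>y. norm (A y w - A x w - A' (y - x) w) / norm (y - x)"
  let ?c = "real (card (frame :: 'a set))"
  have "bounded_linear (\<lambda>u. - B x (A' u w))"
    using lin linear_B[OF x]
    by (intro finite_dim_linear_imp_bounded_linear linear_compose_neg)
      (auto dest: linear_compose simp: o_def)
  moreover have "((\<lambda>y. norm (B y v - B x v - - B x (A' (y - x) w)) / norm (y - x)) \<longlongrightarrow> 0) (at x)"
  proof (rule Lim_null_comparison)
    show "\<forall>\<^sub>F y in at x. norm (norm (B y v - B x v - - B x (A' (y - x) w)) / norm (y - x))
        \<le> K * ?q y + e y * ?c"
      using eventually_in_S[OF x] eventually_neq_at_within[of x]
    proof eventually_elim
      case (elim y)
      let ?r = "A y w - A x w - A' (y - x) w"
      let ?s = "B y (A' (y - x) w) - B x (A' (y - x) w)"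
      have "B y v - B x v - - B x (A' (y - x) w) = - (B y ?r + ?s)"
        using inverse_difference[OF x \<open>y \<in> S\<close>, of v]
        by (simp add: w_def[symmetric] linear_diff[OF linear_B[OF \<open>y \<in> S\<close>]])
      then have "norm (B y v - B x v - - B x (A' (y - x) w)) \<le> norm (B y ?r) + norm ?s"
        by (metis norm_minus_cancel norm_triangle_ineq)
      moreover have "norm (B y ?r) \<le> K * norm ?r"
        using B_bound[OF \<open>y \<in> S\<close>] .
      moreover have "norm ?s \<le> e y * ?c * norm (y - x)"
      proof (rule linear_norm_le_frame[where f = "\<lambda>u. B y (A' u w) - B x (A' u w)"])
        show "linear (\<lambda>u. B y (A' u w) - B x (A' u w))"
          using lin linear_B[OF x] linear_B[OF \<open>y \<in> S\<close>]
          by (intro linear_compose_sub) (auto dest: linear_compose simp: o_def)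
        show "norm (B y (A' b w) - B x (A' b w)) \<le> e y" if "b \<in> frame" for b
          unfolding e_def using that by (intro member_le_sum) auto
      qed
      ultimately have "norm (B y v - B x v - - B x (A' (y - x) w)) / norm (y - x)
          \<le> (K * norm ?r + e y * ?c * norm (y - x)) / norm (y - x)"
        by (intro divide_right_mono) auto
      then show ?case using \<open>y \<noteq> x\<close> by (simp add: add_divide_distrib)
    qed
    have "?q \<midarrow>x\<rightarrow> 0"
      using deriv[of w] by (simp add: has_derivative_iff_norm)
    moreover have "e \<midarrow>x\<rightarrow> 0"
      unfolding e_def
    proof (rule tendsto_null_sum)
      show "(\<lambda>y. norm (B y (A' b w) - B x (A' b w))) \<midarrow>x\<rightarrow> 0" for b
        using cont[of "A' b w"] unfolding isCont_def by (intro tendsto_norm_zero LIM_zero)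
    qed
    ultimately show "(\<lambda>y. K * ?q y + e y * ?c) \<midarrow>x\<rightarrow> 0"
      by (intro tendsto_add_zero tendsto_mult_right_zero tendsto_mult_left_zero)
  qed
  ultimately show ?thesis
    unfolding has_derivative_iff_norm w_def by blast
qed

text \<open>
  The derivative \<open>- B x (A' u (B x v))\<close> of the inverse contains only derivatives of \<open>A\<close> and values of
  \<open>B\<close>, so differentiability of \<open>B\<close> to one order gives it to the next.
\<close>

lemma inverse_higher_differentiable_on:
  assumes "\<And>b. higher_differentiable_on S (\<lambda>x. A x b) n"
  shows "higher_differentiable_on S (\<lambda>x. B x v) n"
  using assms
proof (induction n arbitrary: v)
  case 0
  then have "isCont (\<lambda>y. A y b) x" if "x \<in> S" for x b
    using that open_S by (simp add: continuous_on_eq_continuous_at)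
  then show ?case
    using open_S by (simp add: continuous_on_eq_continuous_at inverse_isCont)
next
  case (Suc n)
  let ?A' = "\<lambda>x u b. frechet_derivative (\<lambda>y. A y b) (at x) u"
  note D = higher_differentiable_on_SucD[OF Suc.prems]
  have IH: "higher_differentiable_on S (\<lambda>x. B x v) n" for v
    using Suc.IH[OF higher_differentiable_on_Suc_lower[OF Suc.prems]] .
  have linear_A': "linear (?A' x u)" if x: "x \<in> S" for x u
  proof (rule linearI)
    fix b c :: 'b and r :: real
    have "((\<lambda>y. A y (b + c)) has_derivative (\<lambda>u. ?A' x u b + ?A' x u c)) (at x)"
      by (rule has_derivative_transform_within_open[OF has_derivative_add[OF D(1)[OF x] D(1)[OF x]] open_S x])
        (simp add: linear_add[OF linear_A])
    from fun_cong[OF frechet_derivative_at[OF this], of u] show "?A' x u (b + c) = ?A' x u b + ?A' x u c"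
      by simp
    have "((\<lambda>y. A y (r *\<^sub>R b)) has_derivative (\<lambda>u. r *\<^sub>R ?A' x u b)) (at x)"
      by (rule has_derivative_transform_within_open[OF has_derivative_scaleR_right[OF D(1)[OF x]] open_S x])
        (simp add: linear_scale[OF linear_A])
    from fun_cong[OF frechet_derivative_at[OF this], of u] show "?A' x u (r *\<^sub>R b) = r *\<^sub>R ?A' x u b"
      by simp
  qed
  show ?case
  proof (rule higher_differentiable_on_SucI[OF open_S])
    show "((\<lambda>y. B y v) has_derivative (\<lambda>u. - B x (?A' x u (B x v)))) (at x)" if "x \<in> S" for x
      using inverse_has_derivative[OF that D(1)[OF that]] .
    fix u
    have "higher_differentiable_on S (\<lambda>x. ?A' x u (B x v)) n"
      by (rule higher_differentiable_on_apply[OF open_S linear_A' D(2) IH])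
    then have "higher_differentiable_on S (\<lambda>x. B x (?A' x u (B x v))) n"
      by (rule higher_differentiable_on_apply[OF open_S linear_B IH, rotated])
    then show "higher_differentiable_on S (\<lambda>x. - B x (?A' x u (B x v))) n"
      by (rule higher_differentiable_on_bounded_linear[OF open_S bounded_linear_minus[OF bounded_linear_ident]])
  qed
qed

end

text \<open>
  By the mean value inequality \<open>H x - x\<close> is a contraction on the ball, so \<open>H\<close> is injective there
  with a Lipschitz inverse. The radii leave room: targets within \<open>r / 4\<close> of \<open>H a\<close> have solutions
  in the closed ball of radius \<open>r / 2\<close>, inside the open ball where the hypotheses hold. The
  smoothness of \<open>g\<close> is a bootstrap on the formula \<open>Dg y = (DH (g y))\<^sup>-\<^sup>1\<close>.
\<close>

lemma smooth_inverse_near_identity: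
  fixes H :: "'a::finite_dim_inner \<Rightarrow> 'a"
  assumes "0 < r" and smooth: "smooth_on (ball a r) H"
    and near: "\<And>x v. x \<in> ball a r \<Longrightarrow> norm (frechet_derivative H (at x) v - v) \<le> norm v / 2"
  shows "\<exists>T g. open T \<and> H a \<in> T \<and> g ` T \<subseteq> ball a r \<and> smooth_on T g \<and> (\<forall>y\<in>T. H (g y) = y)"
proof -
  define D where "D x = frechet_derivative H (at x)" for x
  have H': "(H has_derivative D x) (at x)" if "x \<in> ball a r" for x
    using smooth higher_differentiable_on_SucD(1)[OF _ that, of H 0]
    unfolding smooth_on_def D_def by blast
  have linear_D: "linear (D x)" if "x \<in> ball a r" for x
    using has_derivative_linear[OF H'[OF that]] .
  have contract: "norm ((H x - x) - (H y - y)) \<le> 1 / 2 * norm (x - y)"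
    if "x \<in> ball a r" "y \<in> ball a r" for x y
  proof (rule differentiable_bound[OF convex_ball _ _ that])
    show "((\<lambda>x. H x - x) has_derivative (\<lambda>v. D x v - v)) (at x within ball a r)"
      if "x \<in> ball a r" for x
      using has_derivative_at_withinI[OF has_derivative_diff[OF H'[OF that] has_derivative_ident]] .
    show "onorm (\<lambda>v. D x v - v) \<le> 1 / 2" if "x \<in> ball a r" for x
      using near[OF that] by (intro onorm_bound) (auto simp: D_def)
  qed
  have expand: "norm (x - y) \<le> 2 * norm (H x - H y)" if "x \<in> ball a r" "y \<in> ball a r" for x y
    using contract[OF that] norm_triangle_ineq3[of "H x - H y" "x - y"] by (simp add: algebra_simps)
  define T where "T = ball (H a) (r / 4)"
  have "\<exists>x\<in>cball a (r / 2). H x = y" if "y \<in> T" for y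
  proof (rule near_identity_covers)
    show "norm ((H x - x) - (H y - y)) \<le> norm (x - y) / 2"
      if "x \<in> cball a (r / 2)" "y \<in> cball a (r / 2)" for x y
      using contract[of x y] that \<open>0 < r\<close> by simp
    show "norm (y - H a) \<le> r / 2 / 2"
      using that by (simp add: T_def dist_norm norm_minus_commute)
  qed
  then obtain g where g: "\<And>y. y \<in> T \<Longrightarrow> g y \<in> cball a (r / 2)" "\<And>y. y \<in> T \<Longrightarrow> H (g y) = y"
    by metis
  then have g_ball: "g y \<in> ball a r" if "y \<in> T" for y
    using g(1)[OF that] \<open>0 < r\<close> by simp
  have "open T" "H a \<in> T"
    using \<open>0 < r\<close> by (auto simp: T_def)
  have cont: "continuous_on T g"
  proof (rule continuous_on_subset[OF lipschitz_on_continuous_on[of 2]])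
    show "2-lipschitz_on T g"
      using expand[OF g_ball g_ball] by (intro lipschitz_onI) (simp_all add: dist_norm g(2))
  qed simp
  note B = near_identity_linear_inverse[OF linear_D near[folded D_def]]
  interpret inverse_family "ball a r" D "\<lambda>x. inv_into UNIV (D x)" 2
    by (rule inverse_family.intro[OF open_ball linear_D B])
  have "higher_differentiable_on (ball a r) (\<lambda>x. D x b) n" for b n
    using smooth higher_differentiable_on_SucD(2)[of _ H n b] unfolding smooth_on_def D_def by blast
  then have inv_smooth: "higher_differentiable_on (ball a r) (\<lambda>x. inv_into UNIV (D x) v) n" for v n
    by (rule inverse_higher_differentiable_on)
  have "higher_differentiable_on T g n" for n
  proof (induction n)
    case 0
    then show ?case using cont by simp
  next
    case (Suc n)
    show ?case
    proof (rule higher_differentiable_on_SucI[OF \<open>open T\<close>])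
      fix y assume y: "y \<in> T"
      show "(g has_derivative inv_into UNIV (D (g y))) (at y)"
      proof (rule has_derivative_inverse_basic[OF H'[OF g_ball[OF y]] _ _ _ \<open>open T\<close> y g(2)])
        show "bounded_linear (inv_into UNIV (D (g y)))"
          by (rule finite_dim_linear_imp_bounded_linear[OF linear_B[OF g_ball[OF y]]])
        show "inv_into UNIV (D (g y)) \<circ> D (g y) = id"
          using B_A[OF g_ball[OF y]] by auto
        show "continuous (at y) g"
          using cont \<open>open T\<close> y by (simp add: continuous_on_eq_continuous_at)
      qed
    next
      show "higher_differentiable_on T (\<lambda>y. inv_into UNIV (D (g y)) v) n" for v
        by (rule higher_differentiable_on_compose[OF \<open>open T\<close> open_ball _ Suc inv_smooth])
          (use g_ball in blast)
    qed
  qed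
  then show ?thesis
    using \<open>open T\<close> \<open>H a \<in> T\<close> g(2) g_ball unfolding smooth_on_def by blast
qed

section \<open>Local sections of submersions\<close>

text \<open>
  Restricting \<open>F\<close> to the affine subspace through \<open>p\<close> that is the image of a linear right inverse of the
  derivative reduces the statement to a map between spaces of the same dimension.
\<close>

lemma submersion_smooth_local_section:
  fixes F :: "'a::finite_dim_inner \<Rightarrow> 'b::finite_dim_inner"
  assumes "open S" "p \<in> S" and smooth: "smooth_on S F" and surj: "surj (frechet_derivative F (at p))"
  shows "\<exists>T \<sigma>. open T \<and> F p \<in> T \<and> \<sigma> ` T \<subseteq> S \<and> smooth_on T \<sigma> \<and> (\<forall>y\<in>T. F (\<sigma> y) = y)"
proof -
  define D where "D x = frechet_derivative F (at x)" for x
  have F': "(F has_derivative D x) (at x)" if "x \<in> S" for x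
    using smooth higher_differentiable_on_SucD(1)[OF _ that, of F 0]
    unfolding smooth_on_def D_def by blast
  \<comment> \<open>A right inverse of \<open>D p\<close> is determined by preimages of the frame vectors.\<close>
  define R where "R v = (\<Sum>b\<in>frame. (v \<bullet> b) *\<^sub>R inv_into UNIV (D p) b)" for v
  have "linear R"
    by (rule linearI)
      (simp_all add: R_def inner_add_left scaleR_add_left sum.distrib scaleR_sum_right)
  then have R: "bounded_linear R"
    by (rule finite_dim_linear_imp_bounded_linear)
  have "D p (R v) = v" for v
    using surj has_derivative_linear[OF F'[OF \<open>p \<in> S\<close>]]
    by (simp add: R_def linear_sum linear_scale surj_f_inv_f D_def frame_expansion)
  define S' where "S' = {x. p + R x \<in> S}"
  have "continuous_on UNIV (\<lambda>x. p + R x)"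
    using linear_continuous_on[OF R] by (intro continuous_intros)
  then have "open S'"
    using open_vimage[OF \<open>open S\<close>] by (simp add: S'_def vimage_def)
  define H where "H x = F (p + R x)" for x
  have H': "(H has_derivative (\<lambda>v. D (p + R x) (R v))) (at x)" if "x \<in> S'" for x
  proof -
    have "((\<lambda>x. p + R x) has_derivative R) (at x)"
      using has_derivative_add[OF has_derivative_const bounded_linear_imp_has_derivative[OF R]] by simp
    then show ?thesis
      using has_derivative_compose[OF _ F'] that unfolding H_def S'_def by blast
  qed
  have affine_smooth: "smooth_on U (\<lambda>x. p + R x)" if "open U" for U
    using higher_differentiable_on_affine[OF that R] unfolding smooth_on_def by blast
  have H_smooth: "smooth_on S' H"
    unfolding H_def
    by (rule smooth_on_compose[OF \<open>open S'\<close> \<open>open S\<close> _ affine_smooth[OF \<open>open S'\<close>] smooth])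
      (auto simp: S'_def)
  define E where "E x = frechet_derivative H (at x)" for x
  have E: "E x = (\<lambda>v. D (p + R x) (R v))" if "x \<in> S'" for x
    using frechet_derivative_at[OF H'[OF that]] by (simp add: E_def)
  have "0 \<in> S'"
    using \<open>p \<in> S\<close> by (simp add: S'_def linear_0[OF \<open>linear R\<close>])
  have E0: "E 0 v = v" for v
    using E[OF \<open>0 \<in> S'\<close>] \<open>D p (R v) = v\<close> by (simp add: linear_0[OF \<open>linear R\<close>])
  define k where "k = real (card (frame :: 'b set))"
  \<comment> \<open>The sum of \<open>k\<close> directional errors below \<open>e\<close> has to stay below 1/2, and \<open>k\<close> may be 0.\<close>
  define e where "e = 1 / (2 * (k + 1))"
  have e: "0 < e" "e * k \<le> 1 / 2"
    by (auto simp: e_def k_def field_simps)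
  have "\<forall>\<^sub>F x in nhds 0. norm (E x b - b) < e" for b
  proof -
    have "higher_differentiable_on S' (\<lambda>x. E x b) 0"
      using H_smooth higher_differentiable_on_SucD(2)[of S' H 0 b] unfolding smooth_on_def E_def by blast
    then have "isCont (\<lambda>x. E x b) 0"
      using \<open>open S'\<close> \<open>0 \<in> S'\<close> by (simp add: continuous_on_eq_continuous_at)
    then have "((\<lambda>x. E x b) \<longlongrightarrow> E 0 b) (nhds 0)"
      using tendsto_at_iff_tendsto_nhds[of "\<lambda>x. E x b" 0] by (simp add: isCont_def)
    then show ?thesis
      using e(1) by (auto simp: tendsto_iff dist_norm E0)
  qed
  then have "\<forall>\<^sub>F x in nhds 0. (\<forall>b\<in>frame. norm (E x b - b) < e) \<and> x \<in> S'"
    using \<open>open S'\<close> \<open>0 \<in> S'\<close>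
    by (intro eventually_conj eventually_ball_finite) (auto simp: eventually_nhds)
  then obtain r where r: "0 < r"
    "\<And>x. x \<in> ball 0 r \<Longrightarrow> (\<forall>b\<in>frame. norm (E x b - b) < e) \<and> x \<in> S'"
    by (auto simp: eventually_nhds_metric dist_commute)
  have near: "norm (E x v - v) \<le> norm v / 2" if "x \<in> ball 0 r" for x v
  proof -
    have "linear (E x)"
      using H'[of x] r(2)[OF that] E[of x] has_derivative_linear by metis
    then have "norm (E x v - v) \<le> e * k * norm v"
      unfolding k_def using r(2)[OF that]
      by (intro linear_norm_le_frame[of "\<lambda>v. E x v - v"] linear_compose_sub linear_ident) (auto intro: less_imp_le)
    also have "\<dots> \<le> 1 / 2 * norm v"
      using e(2) by (intro mult_right_mono) auto
    finally show ?thesis by simp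
  qed
  have "smooth_on (ball 0 r) H"
    using H_smooth r(2) higher_differentiable_on_subset unfolding smooth_on_def by blast
  from smooth_inverse_near_identity[OF r(1) this near[unfolded E_def]]
  obtain T g where T: "open T" "H 0 \<in> T" "g ` T \<subseteq> ball 0 r" "smooth_on T g" "\<forall>y\<in>T. H (g y) = y"
    by blast
  have "smooth_on T (\<lambda>y. p + R (g y))"
    by (rule smooth_on_compose[OF T(1) open_UNIV subset_UNIV T(4) affine_smooth[OF open_UNIV]])
  moreover have "p + R (g y) \<in> S" if "y \<in> T" for y
    using that T(3) r(2) by (auto simp: S'_def)
  moreover have "H 0 = F p"
    by (simp add: H_def linear_0[OF \<open>linear R\<close>])
  ultimately show ?thesis
    using T(1,2,5) unfolding H_def by (intro exI[of _ T] exI[of _ "\<lambda>y. p + R (g y)"]) auto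
qed

section \<open>Restriction of charts\<close>

lemma is_chart_inj_on: "is_chart T (U, f) \<Longrightarrow> inj_on f U"
  unfolding is_chart_def
  by (auto dest!: homeomorphic_imp_injective_map openin_subset simp: inf_absorb2)

lemma is_chart_open_image:
  assumes "is_chart T (U, f)" "openin T W" "W \<subseteq> U"
  shows "open (f ` W)"
proof -
  have hom: "homeomorphic_map (subtopology T U) (top_of_set (f ` U)) f" and "open (f ` U)"
    using assms(1) by (auto simp: is_chart_def)
  have "openin (subtopology T U) W"
    using assms(2,3) by (auto simp: openin_subtopology)
  then have "openin (top_of_set (f ` U)) (f ` W)"
    using homeomorphic_imp_open_map[OF hom] by (auto simp: open_map_def)
  then show ?thesis
    using \<open>open (f ` U)\<close> openin_open_trans by blast
qed

lemma is_chart_open_preimage: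
  assumes "is_chart T (U, f)" "open V"
  shows "openin T {x \<in> U. f x \<in> V}"
proof -
  have "openin T U" and cont: "continuous_map (subtopology T U) (top_of_set (f ` U)) f"
    using assms(1) by (auto simp: is_chart_def dest: homeomorphic_imp_continuous_map)
  have "openin (top_of_set (f ` U)) (f ` U \<inter> V)"
    using assms(2) by (simp add: openin_open_Int)
  from openin_continuous_map_preimage[OF cont this]
  have "openin T {x \<in> topspace (subtopology T U). f x \<in> f ` U \<inter> V}"
    using openin_trans_full[OF _ \<open>openin T U\<close>] by blast
  moreover have "{x \<in> topspace (subtopology T U). f x \<in> f ` U \<inter> V} = {x \<in> U. f x \<in> V}"
    using openin_subset[OF \<open>openin T U\<close>] by auto
  ultimately show ?thesis by simp
qed

lemma is_chart_restrict:
  assumes "is_chart T (U, f)" "openin T W" "W \<subseteq> U"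
  shows "is_chart T (W, f)"
proof -
  have "openin T U" and hom: "homeomorphic_map (subtopology T U) (top_of_set (f ` U)) f"
    using assms(1) by (auto simp: is_chart_def)
  have "homeomorphic_map (subtopology (subtopology T U) W) (subtopology (top_of_set (f ` U)) (f ` W)) f"
    using assms(3) openin_subset[OF \<open>openin T U\<close>]
    by (intro homeomorphic_map_subtopologies[OF hom]) auto
  then have "homeomorphic_map (subtopology T W) (top_of_set (f ` W)) f"
    using assms(3) by (simp add: subtopology_subtopology inf_absorb2 image_mono)
  then show ?thesis
    using assms is_chart_open_image[OF assms] by (simp add: is_chart_def)
qed

lemma smoothly_compatible_restrict:
  assumes "is_chart T (U, f)" "is_chart T (V, g)" "openin T W" "W \<subseteq> U"
    and "smoothly_compatible (U, f) (V, g)"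
  shows "smoothly_compatible (W, f) (V, g)"
proof -
  have "openin T V" using assms(2) by (simp add: is_chart_def)
  then have W': "openin T (W \<inter> V)" using assms(3) by (rule openin_Int[rotated])
  have sub: "W \<inter> V \<subseteq> U \<inter> V" using assms(4) by blast
  have "(g \<circ> inv_into U f) x = (g \<circ> inv_into W f) x" if "x \<in> f ` (W \<inter> V)" for x
    using that assms(4) inj_on_subset[OF is_chart_inj_on[OF assms(1)] assms(4)]
      is_chart_inj_on[OF assms(1)] by auto
  moreover have "open (f ` (W \<inter> V))"
    using is_chart_open_image[OF assms(1) W'] assms(4) by blast
  moreover have "smooth_on (f ` (W \<inter> V)) (g \<circ> inv_into U f)"
    and "smooth_on (g ` (W \<inter> V)) (f \<circ> inv_into V g)"
    using assms(5) smooth_on_subset[OF _ image_mono[OF sub]] by (auto simp: smoothly_compatible_def)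
  ultimately have "smooth_on (f ` (W \<inter> V)) (g \<circ> inv_into W f)"
    using smooth_on_cong by blast
  with \<open>smooth_on (g ` (W \<inter> V)) (f \<circ> inv_into V g)\<close> show ?thesis
    by (simp add: smoothly_compatible_def)
qed

lemma smooth_manifold_chart:
  assumes "smooth_manifold M" "c \<in> charts M"
  shows "is_chart (mtop M) c"
  using assms by (auto simp: smooth_manifold_def smooth_atlas_def)

lemma smooth_manifold_compatible:
  assumes "smooth_manifold M" "c \<in> charts M" "d \<in> charts M"
  shows "smoothly_compatible c d"
  using assms by (auto simp: smooth_manifold_def smooth_atlas_def)

text \<open>
  The atlas of a manifold is maximal, so charts can be shrunk at will. The smoothness condition for a map
  requires the whole chart domain in the source to be mapped into one chart domain of the target, and
  shrinking achieves this.
\<close>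

lemma smooth_manifold_restrict_chart:
  assumes "smooth_manifold M" "(U, f) \<in> charts M" "openin (mtop M) W" "W \<subseteq> U"
  shows "(W, f) \<in> charts M"
proof -
  note U = smooth_manifold_chart[OF assms(1,2)]
  have "smoothly_compatible (W, f) d" if "d \<in> charts M" for d
    using smoothly_compatible_restrict[OF U _ assms(3,4), of "fst d" "snd d"]
      smooth_manifold_chart[OF assms(1) that] smooth_manifold_compatible[OF assms(1,2) that] by simp
  then have "(W, f) \<in> maximal_atlas (mtop M) (charts M)"
    using is_chart_restrict[OF U assms(3,4)] by (simp add: maximal_atlas_def)
  then show ?thesis
    using assms(1) by (simp add: smooth_manifold_def)
qed

section \<open>Smooth maps on quotients\<close>

text \<open>
  Near \<open>n = q p\<close> the map \<open>s\<close> is \<open>t\<close> composed with a local section of \<open>q\<close>. The charts \<open>(U, f)\<close> and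
  \<open>(U', f')\<close> around \<open>p\<close> in which \<open>q\<close> and \<open>t\<close> are known to be smooth may differ, so \<open>t\<close> is first
  rewritten in the chart \<open>(U, f)\<close> on the overlap \<open>P\<close>. The section is taken with values in \<open>P\<close>, and the
  chart \<open>(V, g)\<close> of \<open>N\<close> is shrunk to the domain of the section.
\<close>

lemma smooth_map_descends_along_submersion:
  assumes M: "smooth_manifold M" and N: "smooth_manifold N"
    and q: "smooth_submersion M N q" and onto: "q ` points M = points N"
    and t: "smooth_map M Y t" and st: "\<And>x. x \<in> points M \<Longrightarrow> t x = s (q x)"
  shows "smooth_map N Y s"
  unfolding smooth_map_def
proof (intro conjI ballI)
  show "s \<in> points N \<rightarrow> points Y"
  proof (rule funcsetI)
    fix n assume "n \<in> points N"
    then obtain p where "p \<in> points M" "n = q p"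
      using onto by blast
    moreover have "t \<in> points M \<rightarrow> points Y"
      using t by (simp add: smooth_map_def)
    ultimately show "s n \<in> points Y"
      using st[of p] funcset_mem by metis
  qed
next
  fix n assume "n \<in> points N"
  then obtain p where p: "p \<in> points M" "n = q p"
    using onto by blast
  have "smooth_map M N q" using q by (simp add: smooth_submersion_def)
  then obtain U f V g where Uf: "(U, f) \<in> charts M" and Vg: "(V, g) \<in> charts N"
    and "p \<in> U" "q ` U \<subseteq> V" and q_smooth: "smooth_on (f ` U) (g \<circ> q \<circ> inv_into U f)"
    using p(1) unfolding smooth_map_def by blast
  obtain U' f' W h where U'f': "(U', f') \<in> charts M" and Wh: "(W, h) \<in> charts Y"
    and "p \<in> U'" "t ` U' \<subseteq> W" and t_smooth: "smooth_on (f' ` U') (h \<circ> t \<circ> inv_into U' f')"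
    using p(1) t unfolding smooth_map_def by blast
  note U = smooth_manifold_chart[OF M Uf] and U' = smooth_manifold_chart[OF M U'f']
    and V = smooth_manifold_chart[OF N Vg]
  have inj_f: "inj_on f U" and inj_f': "inj_on f' U'" and inj_g: "inj_on g V"
    using U U' V by (auto dest: is_chart_inj_on)
  define P where "P = U \<inter> U'"
  have "openin (mtop M) P"
    using U U' by (auto simp: P_def is_chart_def)
  then have open_fP: "open (f ` P)"
    by (rule is_chart_open_image[OF U]) (simp add: P_def)
  have open_f': "open (f' ` U')"
    using U' by (simp add: is_chart_def)
  have inv_f: "inv_into U f (f x) = x" if "x \<in> P" for x
    using that inj_f by (simp add: P_def)
  have change: "smooth_on (f ` P) (f' \<circ> inv_into U f)"
    using smooth_manifold_compatible[OF M Uf U'f'] by (simp add: smoothly_compatible_def P_def)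
  have "(f' \<circ> inv_into U f) ` (f ` P) \<subseteq> f' ` U'"
    using inv_f by (auto simp: P_def)
  from smooth_on_compose[OF open_fP open_f' this change t_smooth]
  have t_local: "smooth_on (f ` P) (h \<circ> t \<circ> inv_into U f)"
  proof (rule smooth_on_cong[OF open_fP, rotated])
    fix z assume "z \<in> f ` P"
    then obtain x where x: "x \<in> P" "z = f x" by blast
    then have "inv_into U' f' (f' x) = x"
      using inj_f' by (simp add: P_def)
    then show "(h \<circ> t \<circ> inv_into U' f') ((f' \<circ> inv_into U f) z) = (h \<circ> t \<circ> inv_into U f) z"
      using x by (simp add: inv_f)
  qed
  have surj: "surj (frechet_derivative (g \<circ> q \<circ> inv_into U f) (at (f p)))"
  proof -
    have "\<forall>(U, f)\<in>charts M. \<forall>(V, g)\<in>charts N. p \<in> U \<longrightarrow> q p \<in> V \<longrightarrow>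
        surj (frechet_derivative (g \<circ> q \<circ> inv_into U f) (at (f p)))"
      using q p(1) by (simp add: smooth_submersion_def)
    from bspec[OF this Uf] have "\<forall>(V, g)\<in>charts N. p \<in> U \<longrightarrow> q p \<in> V \<longrightarrow>
        surj (frechet_derivative (g \<circ> q \<circ> inv_into U f) (at (f p)))"
      by simp
    from bspec[OF this Vg] show ?thesis
      using \<open>p \<in> U\<close> \<open>q ` U \<subseteq> V\<close> by auto
  qed
  have fp: "f p \<in> f ` P"
    using \<open>p \<in> U\<close> \<open>p \<in> U'\<close> by (simp add: P_def)
  have q_local: "smooth_on (f ` P) (g \<circ> q \<circ> inv_into U f)"
    by (rule smooth_on_subset[OF q_smooth]) (auto simp: P_def)
  obtain T \<sigma> where T: "open T" "(g \<circ> q \<circ> inv_into U f) (f p) \<in> T" "\<sigma> ` T \<subseteq> f ` P"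
    "smooth_on T \<sigma>" "\<forall>y\<in>T. (g \<circ> q \<circ> inv_into U f) (\<sigma> y) = y"
    using submersion_smooth_local_section[OF open_fP fp q_local surj] by blast
  have gqp: "g (q p) \<in> T"
    using T(2) inj_f \<open>p \<in> U\<close> by simp
  define V' where "V' = {v \<in> V. g v \<in> T}"
  have "openin (mtop N) V'"
    unfolding V'_def by (rule is_chart_open_preimage[OF V T(1)])
  have V'_sub: "V' \<subseteq> V" by (auto simp: V'_def)
  have V'g: "(V', g) \<in> charts N"
    using smooth_manifold_restrict_chart[OF N Vg \<open>openin (mtop N) V'\<close> V'_sub] .
  \<comment> \<open>\<open>\<tau>\<close> is the section with values in the manifold, \<open>\<sigma>\<close> its expression in the chart \<open>f\<close>.\<close>
  define \<tau> where "\<tau> y = inv_into U f (\<sigma> y)" for y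
  have \<tau>: "\<tau> y \<in> P" "q (\<tau> y) \<in> V" "g (q (\<tau> y)) = y" if "y \<in> T" for y
  proof -
    have "\<sigma> y \<in> f ` P"
      using subsetD[OF T(3) imageI[OF that]] .
    then obtain x where x: "\<sigma> y = f x" "x \<in> P"
      by (rule imageE)
    then show "\<tau> y \<in> P" by (simp add: \<tau>_def inv_f)
    then show "q (\<tau> y) \<in> V" using \<open>q ` U \<subseteq> V\<close> by (auto simp: P_def)
    show "g (q (\<tau> y)) = y" using T(5) that by (simp add: \<tau>_def)
  qed
  have s_local: "s v = t (\<tau> (g v))" if "v \<in> V'" for v
  proof -
    have "g v \<in> T" "v \<in> V" using that by (auto simp: V'_def)
    then have "q (\<tau> (g v)) = v"
      using \<tau>[of "g v"] inj_g by (auto dest: inj_onD)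
    moreover have "\<tau> (g v) \<in> points M"
      using \<tau>(1)[OF \<open>g v \<in> T\<close>] openin_subset[OF \<open>openin (mtop M) P\<close>] by blast
    ultimately show ?thesis using st by metis
  qed
  have "g ` V' \<subseteq> T" by (auto simp: V'_def)
  have open_gV': "open (g ` V')"
    using is_chart_open_image[OF V \<open>openin (mtop N) V'\<close> V'_sub] .
  have "\<sigma> ` g ` V' \<subseteq> f ` P"
    using image_mono[OF \<open>g ` V' \<subseteq> T\<close>] T(3) by (rule subset_trans)
  from smooth_on_compose[OF open_gV' open_fP this smooth_on_subset[OF T(4) \<open>g ` V' \<subseteq> T\<close>] t_local]
  have "smooth_on (g ` V') (h \<circ> s \<circ> inv_into V' g)"
  proof (rule smooth_on_cong[OF open_gV', rotated])
    fix y assume "y \<in> g ` V'"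
    then obtain v where v: "v \<in> V'" "y = g v" by blast
    then have "inv_into V' g y = v"
      using inj_on_subset[OF inj_g V'_sub] by simp
    then show "(h \<circ> t \<circ> inv_into U f) (\<sigma> y) = (h \<circ> s \<circ> inv_into V' g) y"
      using s_local[OF v(1)] v(2) by (simp add: \<tau>_def)
  qed
  moreover have "s ` V' \<subseteq> W"
    using s_local \<tau>(1) \<open>t ` U' \<subseteq> W\<close> by (auto simp: P_def V'_def)
  moreover have "n \<in> V'"
    using p(2) gqp \<open>p \<in> U\<close> \<open>q ` U \<subseteq> V\<close> by (auto simp: V'_def)
  ultimately show "\<exists>(U, f)\<in>charts N. \<exists>(V, g)\<in>charts Y.
      n \<in> U \<and> s ` U \<subseteq> V \<and> smooth_on (f ` U) (g \<circ> s \<circ> inv_into U f)"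
    using V'g Wh by blast
qed

text \<open>
  Only the values of \<open>s\<close> on the points of the orbit space are determined; membership in
  \<open>extensional\<close> fixes the others, so that uniqueness holds for \<open>s\<close> as a total function.
\<close>

theorem corollary1:
  fixes G :: "('g, 'm) monoid_scheme"
    and L :: "('g, 'l::finite_dim_inner) manifold"
    and Xt :: "('a, 'e::finite_dim_inner) manifold"
    and X :: "('a set, 'f::finite_dim_inner) manifold"
    and Y :: "('b, 'h::finite_dim_inner) manifold"
    and \<phi> :: "'g \<Rightarrow> 'a \<Rightarrow> 'a"
    and st :: "'a \<Rightarrow> 'b"
  assumes "lie_group G L"
    and "smooth_manifold Xt"
    and "smooth_action G L Xt \<phi>"
    and "free_action G (points Xt) \<phi>"
    and "proper_action (mtop L) (mtop Xt) \<phi>"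
    and "quotient_manifold G L Xt \<phi> X"
    and "smooth_manifold Y"
    and "smooth_map Xt Y st"
    and "\<forall>x\<in>points Xt. \<forall>\<gamma>\<in>carrier G. st x = st (\<phi> \<gamma> x)"
  shows "\<exists>!s. s \<in> extensional (points X) \<and> smooth_map X Y s \<and>
           (\<forall>x\<in>points Xt. st x = (s \<circ> orbit G \<phi>) x)"
proof -
  let ?q = "orbit G \<phi>"
  have X: "smooth_manifold X" "smooth_submersion Xt X ?q"
    and onto: "?q ` points Xt = points X"
    using assms(6) by (auto simp: quotient_manifold_def orbits_def)
  interpret group_action G "points Xt" \<phi>
    using assms(3) by (simp add: smooth_action_def)
  have fibres: "st x = st x'" if "x \<in> points Xt" "x' \<in> points Xt" "?q x = ?q x'" for x x'
  proof -
    have "x' \<in> ?q x"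
      using orbit_refl[OF that(2)] that(3) by simp
    then show ?thesis
      using assms(9) that(1) by (auto simp: orbit_def)
  qed
  define s where "s = (\<lambda>n\<in>points X. st (inv_into (points Xt) ?q n))"
  have s: "st x = s (?q x)" if "x \<in> points Xt" for x
  proof -
    have qx: "?q x \<in> ?q ` points Xt" using that by blast
    have "st x = st (inv_into (points Xt) ?q (?q x))"
      by (rule fibres[OF that inv_into_into[OF qx] f_inv_into_f[OF qx, symmetric]])
    then show ?thesis
      using qx onto by (simp add: s_def)
  qed
  show ?thesis
  proof (rule ex1I)
    show "s \<in> extensional (points X) \<and> smooth_map X Y s \<and> (\<forall>x\<in>points Xt. st x = (s \<circ> ?q) x)"
    proof (intro conjI ballI)
      show "s \<in> extensional (points X)" by (simp add: s_def)
      show "smooth_map X Y s"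
        by (rule smooth_map_descends_along_submersion[OF assms(2) X onto assms(8) s])
      show "st x = (s \<circ> ?q) x" if "x \<in> points Xt" for x
        using s[OF that] by simp
    qed
  next
    fix s' assume s': "s' \<in> extensional (points X) \<and> smooth_map X Y s' \<and>
      (\<forall>x\<in>points Xt. st x = (s' \<circ> ?q) x)"
    have "s' n = s n" if "n \<in> points X" for n
    proof -
      have "n \<in> ?q ` points Xt" using that onto by simp
      then obtain x where x: "n = ?q x" "x \<in> points Xt" by (rule imageE)
      then have "st x = s' n" using s' by simp
      then show ?thesis using s[OF x(2)] x(1) by simp
    qed
    then show "s' = s"
      using s' by (intro extensionalityI[of _ "points X"]) (simp_all add: s_def)
  qed
qed

end
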